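(* Let $\Omega\subseteq\mathbb{R}^2$ be an open, bounded, simply connected polygonal region and let $\mathcal{T}$ be a bipartite triangulation of $\Omega$. Then the red refinement $\mathcal{S}\mathcal{T}$ of $\mathcal{T}$ is a bipartite triangulation.
   Context: A triangulation $\mathcal{T}$ of a bounded open polygonal domain $\mathcal{O}\subseteq\mathbb{R}^2$ (as usual, a domain equal to the interior of its closure, so no slits) is a finite conforming family of closed non-degenerate triangles: their union is the closure of $\mathcal{O}$, and any two distinct triangles meet in the empty set, a common vertex, or a common side. The associated graph $\mathcal{G}_{\mathcal{T}}$ has the triangles of $\mathcal{T}$ as vertices, with an arc between distinct $K,L\in\mathcal{T}$ if $|\partial K\cap\partial L|>0$ (length), i.e. if they share a common side. The triangulation is called bipartite if $\mathcal{G}_{\mathcal{T}}$ is a bipartite graph. The red refinement $\mathcal{S}K$ of a triangle $K$ is the family of four triangles, each similar to $K$, obtained by pairwise connecting the midpoints of the three edges of $K$. The red refinement $\mathcal{S}\mathcal{T}$ of $\mathcal{T}$ is the mesh obtained by applying the red refinement to each element of $\mathcal{T}$. *)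

theory Defs
  imports "HOL-Analysis.Analysis" "Graph_Theory.Pair_Digraph"
begin

type_synonym triangle = "(real^2) set"

text \<open>No slits: the set equals the interior of its closure.
  Openness, boundedness and connectedness are not included.\<close>

definition polygonal :: "(real^2) set \<Rightarrow> bool" where
  "polygonal \<Omega> \<longleftrightarrow>
     interior (closure \<Omega>) = \<Omega> \<and>
     (\<exists>S. finite S \<and> frontier \<Omega> = (\<Union>(a, b)\<in>S. closed_segment a b))"

text \<open>The predicate \<open>2 simplex K\<close> says that \<open>K\<close> is a closed non-degenerate triangle; its vertices
  are its extreme points and its sides are its edges (one-dimensional faces).\<close>

definition triangulation_of :: "triangle set \<Rightarrow> (real^2) set \<Rightarrow> bool" where
  "triangulation_of \<T> \<Omega> \<longleftrightarrow>
     finite \<T> \<and> (\<forall>K\<in>\<T>. 2 simplex K) \<and> \<Union>\<T> = closure \<Omega> \<and>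
     (\<forall>K\<in>\<T>. \<forall>L\<in>\<T>. K \<noteq> L \<longrightarrow>
        K \<inter> L = {} \<or>
        (\<exists>v. v extreme_point_of K \<and> v extreme_point_of L \<and> K \<inter> L = {v}) \<or>
        (\<exists>e. e edge_of K \<and> e edge_of L \<and> K \<inter> L = e))"

text \<open>Undirected graphs are represented by symmetric arc relations.\<close>

definition triangulation_graph :: "triangle set \<Rightarrow> triangle pair_pre_digraph" where
  "triangulation_graph \<T> =
     \<lparr> pverts = \<T>,
       parcs = {(K, L). K \<in> \<T> \<and> L \<in> \<T> \<and> K \<noteq> L \<and> (\<exists>e. e edge_of K \<and> e edge_of L)} \<rparr>"

definition bipartite :: "'a pair_pre_digraph \<Rightarrow> bool" where
  "bipartite G \<longleftrightarrow>
     (\<exists>U V. pverts G = U \<union> V \<and> U \<inter> V = {} \<and> parcs G \<subseteq> U \<times> V \<union> V \<times> U)"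

definition bipartite_triangulation_of :: "triangle set \<Rightarrow> (real^2) set \<Rightarrow> bool" where
  "bipartite_triangulation_of \<T> \<Omega> \<longleftrightarrow>
     triangulation_of \<T> \<Omega> \<and> bipartite (triangulation_graph \<T>)"

text \<open>The first member below is the medial triangle. The corner triangle at the vertex \<open>v\<close> is spanned
  by the points \<open>midpoint v w\<close> with \<open>w\<close> ranging over all vertices, where \<open>w = v\<close> contributes \<open>v\<close>
  itself. See \<open>red_refinement_convex_hull\<close> for the explicit form.\<close>

definition red_refinement :: "triangle \<Rightarrow> triangle set" where
  "red_refinement K =
     (let V = {v. v extreme_point_of K} in
      insert (convex hull {midpoint v w | v w. v \<in> V \<and> w \<in> V \<and> v \<noteq> w})
             ((\<lambda>v. convex hull (midpoint v ` V)) ` V))"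

lemma red_refinement_convex_hull:
  fixes a b c :: "real^2"
  assumes "\<not> affine_dependent {a, b, c}" "a \<noteq> b" "a \<noteq> c" "b \<noteq> c"
  shows "red_refinement (convex hull {a, b, c}) =
    {convex hull {a, midpoint a b, midpoint a c},
     convex hull {b, midpoint b a, midpoint b c},
     convex hull {c, midpoint c a, midpoint c b},
     convex hull {midpoint a b, midpoint b c, midpoint c a}}"
proof -
  have V: "{v. v extreme_point_of (convex hull {a, b, c})} = {a, b, c}"
    using extreme_point_of_convex_hull_affine_independent[OF assms(1)] by auto
  have M: "{midpoint v w | v w. v \<in> {a, b, c} \<and> w \<in> {a, b, c} \<and> v \<noteq> w} =
      {midpoint a b, midpoint b c, midpoint c a}"
    using assms(2-4) midpoint_sym[of b a] midpoint_sym[of c b] midpoint_sym[of c a]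
    by (auto; metis)
  show ?thesis
    unfolding red_refinement_def Let_def V M by (simp add: insert_commute)
qed

definition red_refinement_mesh :: "triangle set \<Rightarrow> triangle set" where
  "red_refinement_mesh \<T> = (\<Union>K\<in>\<T>. red_refinement K)"

end

theory Submission
  imports Defs
begin

text \<open>
  The sub-triangles of a triangle are cut out by comparing its barycentric coordinates with 1/2.
  Hence a sub-triangle meets each side of its parent in the empty set, in the midpoint of the side
  or in one of its two halves, and these possibilities depend only on the side.  So the
  intersection of two sub-triangles is always a common face, which gives conformity.
  The medial triangle meets the boundary of its parent only in the three midpoints, so the new
  graph has two kinds of arcs: between the medial triangle and a corner triangle of the same
  parent, and between corner triangles of adjacent parents.  Giving corner triangles the colour of
  their parent and medial triangles the opposite colour is thus a proper 2-colouring.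
\<close>

section \<open>Signed areas and barycentric coordinates in the plane\<close>

text \<open>The determinant with columns \<open>u\<close> and \<open>v\<close>, that is, twice the
  signed area of the triangle 0, \<open>u\<close>, \<open>v\<close>.\<close>

definition wedge2 :: "real^2 \<Rightarrow> real^2 \<Rightarrow> real" where
  "wedge2 u v = u $ 1 * v $ 2 - u $ 2 * v $ 1"

text \<open>The barycentric coordinate of \<open>x\<close> at the vertex \<open>p\<close>, as a
  ratio of signed areas. The coordinates at \<open>q\<close> and \<open>r\<close> arise by rotating
  the arguments.\<close>

definition bary :: "real^2 \<Rightarrow> real^2 \<Rightarrow> real^2 \<Rightarrow> real^2 \<Rightarrow> real" where
  "bary p q r x = wedge2 (q - x) (r - x) / wedge2 (q - p) (r - p)"

text \<open>Turns non-degeneracy into a nonzero denominator of \<open>bary\<close>, which makes the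
  coordinate identities accessible to field arithmetic.\<close>

lemma collinear_iff_wedge2: "collinear {a, b, c} \<longleftrightarrow> wedge2 (b - a) (c - a) = 0"
proof -
  have *: "collinear {0, u, v} \<longleftrightarrow> wedge2 u v = 0" for u v :: "real^2"
  proof
    assume "collinear {0, u, v}"
    then show "wedge2 u v = 0"
      by (auto simp: collinear_lemma wedge2_def)
  next
    assume w: "wedge2 u v = 0"
    show "collinear {0, u, v}"
    proof (cases "u = 0")
      case False
      then consider "u $ 1 \<noteq> 0" | "u $ 2 \<noteq> 0"
        by (auto simp: vec_eq_iff forall_2)
      then have "\<exists>c. v = c *\<^sub>R u"
      proof cases
        case 1
        then have "v = (v $ 1 / u $ 1) *\<^sub>R u"
          using w by (simp add: vec_eq_iff forall_2 wedge2_def field_simps)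
        then show ?thesis by blast
      next
        case 2
        then have "v = (v $ 2 / u $ 2) *\<^sub>R u"
          using w by (simp add: vec_eq_iff forall_2 wedge2_def field_simps)
        then show ?thesis by blast
      qed
      then show ?thesis by (simp add: collinear_lemma)
    qed simp
  qed
  have "collinear {a, b, c} \<longleftrightarrow> collinear {b, a, c}" by (simp add: insert_commute)
  also have "\<dots> \<longleftrightarrow> collinear {0, b - a, c - a}"
    using collinear_3[of b a c] by (simp add: NO_MATCH_def)
  finally show ?thesis by (simp add: *)
qed

text \<open>Signed area is invariant under rotating the vertices, so the three coordinates share one
  denominator.\<close>

lemma wedge2_cyclic: "wedge2 (c - b) (a - b) = wedge2 (b - a) (c - a)"
  by (simp add: wedge2_def algebra_simps)

lemma bary_affine:
  obtains n d where "\<And>x. bary a b c x = n \<bullet> x + d"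
proof
  fix x
  let ?D = "wedge2 (b - a) (c - a)"
  \<comment> \<open>The products \<open>x $ 1 * x $ 2\<close> cancel on expanding the numerator,
    leaving a linear part and the constant \<open>wedge2 b c\<close>.\<close>
  show "bary a b c x =
     (\<chi> i. if i = 1 then (b $ 2 - c $ 2) / ?D else (c $ 1 - b $ 1) / ?D) \<bullet> x + wedge2 b c / ?D"
    unfolding bary_def add_divide_distrib[symmetric]
    by (simp add: inner_vec_def sum_2 wedge2_def flip: add_divide_distrib)
       (simp add: algebra_simps)
qed

lemma bary_sum:
  assumes "\<not> collinear {a, b, c}"
  shows "bary a b c x + bary b c a x + bary c a b x = 1"
  using assms
  unfolding bary_def wedge2_cyclic[of c b a] wedge2_cyclic[of a c b] collinear_iff_wedge2
  by (simp add: field_simps) (simp add: wedge2_def algebra_simps)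

lemma bary_combination:
  assumes "\<not> collinear {a, b, c}"
  shows "bary a b c x *\<^sub>R a + bary b c a x *\<^sub>R b + bary c a b x *\<^sub>R c = x"
  using assms
  unfolding bary_def wedge2_cyclic[of c b a] wedge2_cyclic[of a c b] collinear_iff_wedge2
  by (simp add: vec_eq_iff forall_2 field_simps) (simp add: wedge2_def algebra_simps)

text \<open>Uniqueness of barycentric coordinates, for weights of any sign; rotating the vertices
  gives the other two.\<close>

lemma bary_of_combination:
  assumes "\<not> collinear {a, b, c}" "u + v + w = 1"
  shows "bary a b c (u *\<^sub>R a + v *\<^sub>R b + w *\<^sub>R c) = u"
proof -
  have u: "u = 1 - v - w" using assms(2) by simp
  show ?thesis
    using assms(1) unfolding u bary_def collinear_iff_wedge2
    by (simp add: field_simps) (simp add: wedge2_def algebra_simps)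
qed

lemma mem_convex_hull_3_iff_bary:
  assumes "\<not> collinear {a, b, c}"
  shows "x \<in> convex hull {a, b, c} \<longleftrightarrow> 0 \<le> bary a b c x \<and> 0 \<le> bary b c a x \<and> 0 \<le> bary c a b x"
proof
  assume "x \<in> convex hull {a, b, c}"
  then obtain u v w where x: "x = u *\<^sub>R a + v *\<^sub>R b + w *\<^sub>R c" "0 \<le> u" "0 \<le> v" "0 \<le> w" "u + v + w = 1"
    by (auto simp: convex_hull_3)
  have "\<not> collinear {b, c, a}" "\<not> collinear {c, a, b}"
    using assms by (simp_all add: insert_commute)
  then show "0 \<le> bary a b c x \<and> 0 \<le> bary b c a x \<and> 0 \<le> bary c a b x"
    using bary_of_combination[of a b c u v w] bary_of_combination[of b c a v w u]
      bary_of_combination[of c a b w u v] assms x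
    by (simp add: algebra_simps)
next
  assume "0 \<le> bary a b c x \<and> 0 \<le> bary b c a x \<and> 0 \<le> bary c a b x"
  then show "x \<in> convex hull {a, b, c}"
    using bary_sum[OF assms, of x] bary_combination[OF assms, of x]
    unfolding convex_hull_3 by (smt (verit) mem_Collect_eq)
qed

lemma mem_closed_segment_iff_bary:
  assumes "\<not> collinear {a, b, c}"
  shows "x \<in> closed_segment a b \<longleftrightarrow> 0 \<le> bary a b c x \<and> 0 \<le> bary b c a x \<and> bary c a b x = 0"
proof
  assume x: "x \<in> closed_segment a b"
  then obtain u where "x = (1 - u) *\<^sub>R a + u *\<^sub>R b"
    by (auto simp: in_segment)
  then have "bary c a b x = 0"
    using bary_of_combination[of c a b 0 "1 - u" u] assms by (simp add: insert_commute)
  moreover have "x \<in> convex hull {a, b, c}"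
    using x hull_mono[of "{a, b}" "{a, b, c}" convex] by (auto simp: segment_convex_hull)
  ultimately show "0 \<le> bary a b c x \<and> 0 \<le> bary b c a x \<and> bary c a b x = 0"
    using mem_convex_hull_3_iff_bary[OF assms] by blast
next
  assume "0 \<le> bary a b c x \<and> 0 \<le> bary b c a x \<and> bary c a b x = 0"
  then show "x \<in> closed_segment a b"
    using bary_sum[OF assms, of x] bary_combination[OF assms, of x]
    unfolding in_segment
    \<comment> \<open>With the third coordinate zero, the coordinate at \<open>a\<close> is 1 minus
      the one at \<open>b\<close>, so the latter is the segment parameter.\<close>
    by (intro exI[of _ "bary b c a x"]) (auto simp: eq_diff_eq[symmetric])
qed

lemma midpoint_nth: "midpoint u v $ i = (u $ i + v $ i) / 2" for u v :: "real^2"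
  by (simp add: midpoint_def)

text \<open>Halving the sides divides the area by four; in particular sub-triangles inherit
  non-degeneracy.\<close>

lemma wedge2_corner:
  "wedge2 (midpoint a b - a) (midpoint a c - a) = wedge2 (b - a) (c - a) / 4"
  by (simp add: wedge2_def midpoint_nth field_simps)

lemma wedge2_medial:
  "wedge2 (midpoint b c - midpoint a b) (midpoint c a - midpoint a b) = wedge2 (b - a) (c - a) / 4"
  by (simp add: wedge2_def midpoint_nth field_simps)

text \<open>The corner triangle is the image of the parent under the homothety of ratio 1/2 about
  \<open>a\<close>. This doubles the coordinates at \<open>b\<close> and \<open>c\<close>, and the
  first is then fixed by the sum 1.\<close>

lemma bary_corner:
  assumes "\<not> collinear {a, b, c}"
  shows "bary a (midpoint a b) (midpoint a c) x = 2 * bary a b c x - 1"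
    and "bary (midpoint a b) (midpoint a c) a x = 2 * bary b c a x"
    and "bary (midpoint a c) a (midpoint a b) x = 2 * bary c a b x"
  using assms
  unfolding bary_def wedge2_cyclic[of a "midpoint a c" "midpoint a b"]
    wedge2_cyclic[of "midpoint a c" "midpoint a b" a]
    wedge2_cyclic[of c b a] wedge2_cyclic[of a c b] collinear_iff_wedge2 wedge2_corner
  by (simp_all add: field_simps) (simp_all add: wedge2_def midpoint_nth field_simps)

text \<open>The homothety of ratio -1/2 about the centroid sends each vertex to the midpoint of the
  opposite side, hence the change of sign and the pairing of midpoints with opposite
  vertices.\<close>

lemma bary_medial:
  assumes "\<not> collinear {a, b, c}"
  shows "bary (midpoint a b) (midpoint b c) (midpoint c a) x = 1 - 2 * bary c a b x"
    and "bary (midpoint b c) (midpoint c a) (midpoint a b) x = 1 - 2 * bary a b c x"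
    and "bary (midpoint c a) (midpoint a b) (midpoint b c) x = 1 - 2 * bary b c a x"
  using assms
  unfolding bary_def wedge2_cyclic[of "midpoint a b" "midpoint c a" "midpoint b c"]
    wedge2_cyclic[of "midpoint c a" "midpoint b c" "midpoint a b"]
    wedge2_cyclic[of c b a] wedge2_cyclic[of a c b] collinear_iff_wedge2 wedge2_medial
  by (simp_all add: field_simps) (simp_all add: wedge2_def midpoint_nth field_simps)

section \<open>Corner and medial triangles in the parent's coordinates\<close>

text \<open>Sub-triangles are addressed by the parent as a set, without an ordering of its vertices,
  so that colours can later be assigned by parent.\<close>

definition corner_triangle :: "triangle \<Rightarrow> real^2 \<Rightarrow> triangle" where
  "corner_triangle K v = convex hull (midpoint v ` {w. w extreme_point_of K})"

definition medial_triangle :: "triangle \<Rightarrow> triangle" where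
  "medial_triangle K =
     convex hull {midpoint v w | v w. v extreme_point_of K \<and> w extreme_point_of K \<and> v \<noteq> w}"

lemma red_refinement_eq:
  "red_refinement K = insert (medial_triangle K) (corner_triangle K ` {v. v extreme_point_of K})"
  by (simp add: red_refinement_def corner_triangle_def medial_triangle_def Let_def)

lemma two_simplex_convex_hull:
  fixes a b c :: "real^2"
  assumes "\<not> collinear {a, b, c}"
  shows "2 simplex (convex hull {a, b, c})"
  using assms unfolding simplex_def collinear_3_eq_affine_dependent
  by (intro exI[of _ "{a, b, c}"]) auto

lemma two_simplexE:
  assumes "2 simplex (K :: (real^2) set)"
  obtains a b c where "\<not> collinear {a, b, c}" "K = convex hull {a, b, c}"
proof -
  obtain C where C: "\<not> affine_dependent C" "card C = 3" "K = convex hull C"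
    using assms by (auto simp: simplex_def)
  then obtain a b c where "C = {a, b, c}" "a \<noteq> b" "a \<noteq> c" "b \<noteq> c"
    by (auto simp: card_3_iff)
  with C show ?thesis
    by (intro that) (auto simp: collinear_3_eq_affine_dependent)
qed

lemma extreme_points_triangle:
  fixes a b c :: "real^2"
  assumes "\<not> collinear {a, b, c}"
  shows "v extreme_point_of convex hull {a, b, c} \<longleftrightarrow> v = a \<or> v = b \<or> v = c"
  using assms extreme_point_of_convex_hull_affine_independent[of "{a, b, c}" v]
  by (auto simp: collinear_3_eq_affine_dependent)

text \<open>Symmetry reduction: a given vertex may be listed first, so coordinate facts are needed
  for one ordering only.\<close>

lemma triangle_with_vertex:
  fixes K :: triangle
  assumes "2 simplex K" "v extreme_point_of K"
  obtains b c where "\<not> collinear {v, b, c}" "K = convex hull {v, b, c}"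
proof -
  obtain p q r where K: "\<not> collinear {p, q, r}" "K = convex hull {p, q, r}"
    using assms(1) by (rule two_simplexE)
  then consider "v = p" | "v = q" | "v = r"
    using assms(2) extreme_points_triangle by auto
  then show ?thesis
    using K that[of q r] that[of p r] that[of p q] by cases (auto simp: insert_commute)
qed

lemma triangle_with_two_vertices:
  fixes K :: triangle
  assumes "2 simplex K" "v extreme_point_of K" "w extreme_point_of K" "v \<noteq> w"
  obtains c where "\<not> collinear {v, w, c}" "K = convex hull {v, w, c}"
proof -
  obtain q r where K: "\<not> collinear {v, q, r}" "K = convex hull {v, q, r}"
    using assms(1,2) by (rule triangle_with_vertex)
  then consider "w = q" | "w = r"
    using assms(3,4) extreme_points_triangle by auto
  then show ?thesis
    using K that[of q] that[of r] by cases (auto simp: insert_commute)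
qed

text \<open>A face of a simplex is the hull of some of its vertices, and dimension 1 forces exactly
  two of them.\<close>

lemma triangle_with_edge:
  fixes K :: triangle
  assumes "2 simplex K" "e edge_of K"
  obtains a b c where "\<not> collinear {a, b, c}" "K = convex hull {a, b, c}" "e = closed_segment a b"
proof -
  obtain p q r where K: "\<not> collinear {p, q, r}" "K = convex hull {p, q, r}"
    using assms(1) by (rule two_simplexE)
  then have ind: "\<not> affine_dependent {p, q, r}"
    by (auto simp: collinear_3_eq_affine_dependent)
  obtain C where C: "C \<subseteq> {p, q, r}" "e = convex hull C"
    using assms(2) face_of_convex_hull_affine_independent[OF ind] K(2) by (auto simp: edge_of_def)
  have "\<not> affine_dependent C"
    using ind C(1) affine_dependent_subset by blast
  then have "card C = 2"
    using aff_dim_affine_independent[of C] assms(2) C(2) by (simp add: edge_of_def aff_dim_convex_hull)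
  then obtain a b where ab: "C = {a, b}" "a \<noteq> b"
    by (auto simp: card_2_iff)
  then have "a extreme_point_of K" "b extreme_point_of K"
    using C(1) K extreme_points_triangle by auto
  then obtain c where "\<not> collinear {a, b, c}" "K = convex hull {a, b, c}"
    using assms(1) ab(2) triangle_with_two_vertices by metis
  then show ?thesis
    using that C(2) ab(1) by (simp add: segment_convex_hull)
qed

lemma corner_triangle_convex_hull:
  assumes "\<not> collinear {a, b, c}"
  shows "corner_triangle (convex hull {a, b, c}) a = convex hull {a, midpoint a b, midpoint a c}"
proof -
  have "{w. w extreme_point_of convex hull {a, b, c}} = {a, b, c}"
    using extreme_points_triangle[OF assms] by auto
  then show ?thesis by (simp add: corner_triangle_def)
qed

lemma medial_triangle_convex_hull:
  assumes "\<not> collinear {a, b, c}"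
  shows "medial_triangle (convex hull {a, b, c}) =
    convex hull {midpoint a b, midpoint b c, midpoint c a}"
proof -
  have "a \<noteq> b" "a \<noteq> c" "b \<noteq> c"
    using assms by (auto simp: collinear_3_eq_affine_dependent)
  then have "{midpoint v w | v w. v extreme_point_of convex hull {a, b, c} \<and>
      w extreme_point_of convex hull {a, b, c} \<and> v \<noteq> w} =
      {midpoint a b, midpoint b c, midpoint c a}"
    using midpoint_sym[of b a] midpoint_sym[of c b] midpoint_sym[of c a]
    unfolding extreme_points_triangle[OF assms] by (auto; metis)
  then show ?thesis by (simp add: medial_triangle_def)
qed

lemma not_collinear_corner:
  fixes a b c :: "real^2"
  shows "\<not> collinear {a, b, c} \<Longrightarrow> \<not> collinear {a, midpoint a b, midpoint a c}"
  by (simp add: collinear_iff_wedge2 wedge2_corner)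

lemma not_collinear_medial:
  fixes a b c :: "real^2"
  shows "\<not> collinear {a, b, c} \<Longrightarrow> \<not> collinear {midpoint a b, midpoint b c, midpoint c a}"
  by (simp add: collinear_iff_wedge2 wedge2_medial)

lemma mem_corner_triangle_iff_bary:
  assumes "\<not> collinear {a, b, c}"
  shows "x \<in> corner_triangle (convex hull {a, b, c}) a \<longleftrightarrow>
    1 / 2 \<le> bary a b c x \<and> 0 \<le> bary b c a x \<and> 0 \<le> bary c a b x"
  unfolding corner_triangle_convex_hull[OF assms]
    mem_convex_hull_3_iff_bary[OF not_collinear_corner[OF assms]] bary_corner[OF assms]
  by auto

text \<open>Nonnegativity is implied by these bounds: two coordinates add up to at most 1 and all
  three to exactly 1.\<close>

lemma mem_medial_triangle_iff_bary:
  assumes "\<not> collinear {a, b, c}"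
  shows "x \<in> medial_triangle (convex hull {a, b, c}) \<longleftrightarrow>
    bary a b c x \<le> 1 / 2 \<and> bary b c a x \<le> 1 / 2 \<and> bary c a b x \<le> 1 / 2"
  unfolding medial_triangle_convex_hull[OF assms]
    mem_convex_hull_3_iff_bary[OF not_collinear_medial[OF assms]] bary_medial[OF assms]
  by auto

lemma red_refinement_cases:
  assumes "2 simplex K" "P \<in> red_refinement K"
  obtains (medial) a b c where "\<not> collinear {a, b, c}" "K = convex hull {a, b, c}"
      "P = medial_triangle K"
  | (corner) a b c where "\<not> collinear {a, b, c}" "K = convex hull {a, b, c}"
      "P = corner_triangle K a"
proof -
  consider "P = medial_triangle K" | v where "v extreme_point_of K" "P = corner_triangle K v"
    using assms(2) unfolding red_refinement_eq by blast
  then show ?thesis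
  proof cases
    case 1
    then show ?thesis using two_simplexE[OF assms(1)] medial by metis
  next
    case 2
    then show ?thesis using triangle_with_vertex[OF assms(1)] corner by metis
  qed
qed

lemma red_refinement_two_simplex:
  assumes "2 simplex K" "P \<in> red_refinement K"
  shows "2 simplex P"
  using assms
  by (cases rule: red_refinement_cases)
    (simp_all add: corner_triangle_convex_hull medial_triangle_convex_hull
      two_simplex_convex_hull not_collinear_corner not_collinear_medial)

lemma red_refinement_subset:
  assumes "2 simplex K" "P \<in> red_refinement K"
  shows "P \<subseteq> K"
  using assms
proof (cases rule: red_refinement_cases)
  case (medial a b c)
  show ?thesis
  proof
    fix x assume "x \<in> P"
    then show "x \<in> K"
      using bary_sum[OF medial(1), of x] mem_medial_triangle_iff_bary[OF medial(1), of x]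
        mem_convex_hull_3_iff_bary[OF medial(1), of x] medial by auto
  qed
next
  case (corner a b c)
  then show ?thesis
    using mem_corner_triangle_iff_bary[OF corner(1)] mem_convex_hull_3_iff_bary[OF corner(1)]
    by auto
qed

text \<open>A point of \<open>K\<close> outside the medial triangle has some coordinate above 1/2
  and so lies in the corner at that vertex.\<close>

lemma Union_red_refinement:
  assumes "2 simplex K"
  shows "\<Union>(red_refinement K) = K"
proof
  show "\<Union>(red_refinement K) \<subseteq> K"
    using red_refinement_subset[OF assms] by blast
next
  show "K \<subseteq> \<Union>(red_refinement K)"
  proof
    fix x assume x: "x \<in> K"
    show "x \<in> \<Union>(red_refinement K)"
    proof (cases "x \<in> medial_triangle K")
      case True
      then show ?thesis by (auto simp: red_refinement_eq)
    next
      case False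
      obtain a b c where K: "\<not> collinear {a, b, c}" "K = convex hull {a, b, c}"
        using assms by (rule two_simplexE)
      have K': "\<not> collinear {b, c, a}" "K = convex hull {b, c, a}"
          "\<not> collinear {c, a, b}" "K = convex hull {c, a, b}"
        using K by (simp_all add: insert_commute)
      have "x \<in> corner_triangle K a \<or> x \<in> corner_triangle K b \<or> x \<in> corner_triangle K c"
        using x False mem_medial_triangle_iff_bary[OF K(1), of x]
          mem_convex_hull_3_iff_bary[OF K(1), of x]
          mem_corner_triangle_iff_bary[OF K(1), of x] mem_corner_triangle_iff_bary[OF K'(1), of x]
          mem_corner_triangle_iff_bary[OF K'(3), of x]
        unfolding K(2)[symmetric] K'(2,4)[symmetric] by linarith
      moreover have "a extreme_point_of K" "b extreme_point_of K" "c extreme_point_of K"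
        using K extreme_points_triangle by auto
      ultimately show ?thesis
        by (auto simp: red_refinement_eq)
    qed
  qed
qed

section \<open>Intersections of sub-triangles of one parent\<close>

text \<open>Coordinates are affine, so a level line with \<open>S\<close> on one side is a
  supporting line and cuts out a face.\<close>

lemma face_of_bary_level:
  assumes "convex S" "(\<forall>x\<in>S. bary a b c x \<le> t) \<or> (\<forall>x\<in>S. t \<le> bary a b c x)"
  shows "S \<inter> {x. bary a b c x = t} face_of S"
proof -
  obtain n d where nd: "\<And>x. bary a b c x = n \<bullet> x + d"
    using bary_affine by blast
  have "{x. bary a b c x = t} = {x. n \<bullet> x = t - d}"
    by (auto simp: nd)
  moreover have "S \<inter> {x. n \<bullet> x = t - d} face_of S"
    using assms face_of_Int_supporting_hyperplane_le[where S = S and a = n and b = "t - d"]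
      face_of_Int_supporting_hyperplane_ge[where S = S and a = n and b = "t - d"]
    by (auto simp: nd le_diff_eq diff_le_eq)
  ultimately show ?thesis by simp
qed

lemma convex_corner_triangle [simp]: "convex (corner_triangle K v)"
  by (simp add: corner_triangle_def)

lemma convex_medial_triangle [simp]: "convex (medial_triangle K)"
  by (simp add: medial_triangle_def)

text \<open>The line where the coordinate at \<open>v\<close> is 1/2 separates the two triangles,
  and both meet it in the same set.\<close>

lemma corner_Int_medial_face_of:
  assumes "2 simplex K" "v extreme_point_of K"
  shows "corner_triangle K v \<inter> medial_triangle K face_of corner_triangle K v"
    and "corner_triangle K v \<inter> medial_triangle K face_of medial_triangle K"
proof -
  obtain b c where K: "\<not> collinear {v, b, c}" "K = convex hull {v, b, c}"
    using assms by (rule triangle_with_vertex)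
  note mem = mem_corner_triangle_iff_bary[OF K(1), folded K(2)]
    mem_medial_triangle_iff_bary[OF K(1), folded K(2)]
  note sum = bary_sum[OF K(1)]
  have "corner_triangle K v \<inter> {x. bary v b c x = 1 / 2} face_of corner_triangle K v"
    by (rule face_of_bary_level) (auto simp: mem)
  moreover have "corner_triangle K v \<inter> {x. bary v b c x = 1 / 2} =
      corner_triangle K v \<inter> medial_triangle K"
  proof (rule set_eqI)
    fix x
    show "x \<in> corner_triangle K v \<inter> {x. bary v b c x = 1 / 2} \<longleftrightarrow>
        x \<in> corner_triangle K v \<inter> medial_triangle K"
      using sum[of x] mem[of x] unfolding Int_iff mem_Collect_eq by linarith
  qed
  moreover have "medial_triangle K \<inter> {x. bary v b c x = 1 / 2} face_of medial_triangle K"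
    by (rule face_of_bary_level) (auto simp: mem)
  moreover have "medial_triangle K \<inter> {x. bary v b c x = 1 / 2} =
      corner_triangle K v \<inter> medial_triangle K"
  proof (rule set_eqI)
    fix x
    show "x \<in> medial_triangle K \<inter> {x. bary v b c x = 1 / 2} \<longleftrightarrow>
        x \<in> corner_triangle K v \<inter> medial_triangle K"
      using sum[of x] mem[of x] unfolding Int_iff mem_Collect_eq by linarith
  qed
  ultimately show "corner_triangle K v \<inter> medial_triangle K face_of corner_triangle K v"
    "corner_triangle K v \<inter> medial_triangle K face_of medial_triangle K" by simp_all
qed

text \<open>Two coordinates of at least 1/2 and a nonnegative third one sum to 1 only if there is
  equality throughout.\<close>

lemma mem_two_corner_triangles_iff_bary:
  assumes "\<not> collinear {a, b, c}" "K = convex hull {a, b, c}"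
  shows "x \<in> corner_triangle K a \<inter> corner_triangle K b \<longleftrightarrow>
    bary a b c x = 1 / 2 \<and> bary b c a x = 1 / 2 \<and> bary c a b x = 0"
proof -
  have "\<not> collinear {b, c, a}" "K = convex hull {b, c, a}"
    using assms by (simp_all add: insert_commute)
  note mem = mem_corner_triangle_iff_bary[OF assms(1), folded assms(2)]
    mem_corner_triangle_iff_bary[OF this(1), folded this(2)]
  show ?thesis
    using bary_sum[OF assms(1), of x] by (auto simp: mem)
qed

lemma corner_Int_corner_subset:
  assumes "2 simplex K" "v extreme_point_of K" "w extreme_point_of K" "v \<noteq> w"
  shows "corner_triangle K v \<inter> corner_triangle K w \<subseteq> {midpoint v w}"
proof -
  obtain c where K: "\<not> collinear {v, w, c}" "K = convex hull {v, w, c}"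
    using assms by (rule triangle_with_two_vertices)
  show ?thesis
  proof
    fix x assume "x \<in> corner_triangle K v \<inter> corner_triangle K w"
    then have "bary v w c x = 1 / 2" "bary w c v x = 1 / 2" "bary c v w x = 0"
      using mem_two_corner_triangles_iff_bary[OF K] by blast+
    then have "(1 / 2) *\<^sub>R v + (1 / 2) *\<^sub>R w + 0 *\<^sub>R c = x"
      using bary_combination[OF K(1), of x] by metis
    then show "x \<in> {midpoint v w}"
      by (auto simp: midpoint_def scaleR_add_right)
  qed
qed

text \<open>On the corner at \<open>v\<close> the coordinate at \<open>w\<close> is at most 1/2, and
  the other corner is met exactly where this bound is attained.\<close>

lemma corner_Int_corner_face_of:
  assumes "2 simplex K" "v extreme_point_of K" "w extreme_point_of K" "v \<noteq> w"
  shows "corner_triangle K v \<inter> corner_triangle K w face_of corner_triangle K v"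
proof -
  obtain c where K: "\<not> collinear {v, w, c}" "K = convex hull {v, w, c}"
    using assms by (rule triangle_with_two_vertices)
  note mem = mem_corner_triangle_iff_bary[OF K(1), folded K(2)]
  have "corner_triangle K v \<inter> {x. bary w c v x = 1 / 2} face_of corner_triangle K v"
  proof (rule face_of_bary_level)
    have "bary w c v x \<le> 1 / 2" if "x \<in> corner_triangle K v" for x
      using that bary_sum[OF K(1), of x] mem[of x] by linarith
    then show "(\<forall>x\<in>corner_triangle K v. bary w c v x \<le> 1 / 2) \<or>
        (\<forall>x\<in>corner_triangle K v. 1 / 2 \<le> bary w c v x)" by blast
  qed simp
  moreover have "corner_triangle K v \<inter> {x. bary w c v x = 1 / 2} =
      corner_triangle K v \<inter> corner_triangle K w"
  proof (rule set_eqI)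
    fix x
    show "x \<in> corner_triangle K v \<inter> {x. bary w c v x = 1 / 2} \<longleftrightarrow>
        x \<in> corner_triangle K v \<inter> corner_triangle K w"
      using bary_sum[OF K(1), of x] mem[of x]
      unfolding mem_two_corner_triangles_iff_bary[OF K] unfolding Int_iff mem_Collect_eq by linarith
  qed
  ultimately show ?thesis by simp
qed

lemma red_refinement_Int_face_of:
  assumes "2 simplex K" "P \<in> red_refinement K" "Q \<in> red_refinement K"
  shows "P \<inter> Q face_of P"
proof -
  consider "P = Q" | v where "v extreme_point_of K" "P = medial_triangle K" "Q = corner_triangle K v"
    | v where "v extreme_point_of K" "Q = medial_triangle K" "P = corner_triangle K v"
    | v w where "v extreme_point_of K" "w extreme_point_of K" "v \<noteq> w"
      "P = corner_triangle K v" "Q = corner_triangle K w"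
    using assms(2,3) unfolding red_refinement_eq by blast
  then show ?thesis
  proof cases
    case 1
    then show ?thesis
      using assms(2) by (auto simp: red_refinement_eq intro!: face_of_refl)
  next
    case 2
    then show ?thesis
      using corner_Int_medial_face_of(2)[OF assms(1)] by (simp add: Int_commute)
  next
    case 3
    then show ?thesis
      using corner_Int_medial_face_of(1)[OF assms(1)] by simp
  next
    case 4
    then show ?thesis
      using corner_Int_corner_face_of[OF assms(1)] by simp
  qed
qed

section \<open>Traces of sub-triangles on a side of the parent\<close>

text \<open>The list depends on the endpoints of the side alone, so parents on both sides of a
  common side draw their traces from the same list.\<close>

definition edge_pieces :: "real^2 \<Rightarrow> real^2 \<Rightarrow> (real^2) set set" where
  "edge_pieces a b =
     {{}, {midpoint a b}, closed_segment a (midpoint a b), closed_segment b (midpoint a b)}"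

lemma edge_pieces_commute: "edge_pieces a b = edge_pieces b a"
  by (auto simp: edge_pieces_def midpoint_sym)

text \<open>Distinct halves meet only in the midpoint, which is an endpoint of each.\<close>

lemma edge_pieces_Int_face_of:
  assumes "S \<in> edge_pieces a b" "T \<in> edge_pieces a b"
  shows "S \<inter> T face_of S"
proof -
  let ?m = "midpoint a b"
  have I: "closed_segment a ?m \<inter> closed_segment b ?m = {?m}"
    using Int_closed_segment[of ?m a b] by (simp add: closed_segment_commute[of b])
  have F: "{?m} face_of closed_segment p ?m" for p
    by (simp add: face_of_singleton extreme_point_of_segment)
  have "S = T \<or> S \<inter> T = {} \<or> S \<inter> T = S \<or> S \<inter> T = {?m} \<and> (\<exists>p. S = closed_segment p ?m)"
    using assms I unfolding edge_pieces_def by auto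
  moreover have "convex S"
    using assms(1) unfolding edge_pieces_def by auto
  ultimately show ?thesis
    using F face_of_refl[of S] by auto
qed

text \<open>On the side the coordinate at \<open>c\<close> is 0, so the other two sum to 1; being at
  most 1/2, both equal 1/2.\<close>

lemma medial_Int_edge_subset:
  assumes "\<not> collinear {a, b, c}"
  shows "medial_triangle (convex hull {a, b, c}) \<inter> closed_segment a b \<subseteq> {midpoint a b}"
proof
  fix x assume "x \<in> medial_triangle (convex hull {a, b, c}) \<inter> closed_segment a b"
  then have "bary a b c x \<le> 1 / 2" "bary b c a x \<le> 1 / 2" "bary c a b x = 0"
    unfolding Int_iff mem_medial_triangle_iff_bary[OF assms] mem_closed_segment_iff_bary[OF assms]
    by blast+
  then have "bary a b c x = 1 / 2" "bary b c a x = 1 / 2" "bary c a b x = 0"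
    using bary_sum[OF assms, of x] by linarith+
  then have "(1 / 2) *\<^sub>R a + (1 / 2) *\<^sub>R b + 0 *\<^sub>R c = x"
    using bary_combination[OF assms, of x] by metis
  then show "x \<in> {midpoint a b}"
    by (auto simp: midpoint_def scaleR_add_right)
qed

lemma corner_Int_edge:
  assumes "\<not> collinear {a, b, c}"
  shows "corner_triangle (convex hull {a, b, c}) a \<inter> closed_segment a b =
    closed_segment a (midpoint a b)"
proof (rule set_eqI)
  fix x
  show "x \<in> corner_triangle (convex hull {a, b, c}) a \<inter> closed_segment a b \<longleftrightarrow>
      x \<in> closed_segment a (midpoint a b)"
    unfolding Int_iff mem_corner_triangle_iff_bary[OF assms] mem_closed_segment_iff_bary[OF assms]
      mem_closed_segment_iff_bary[OF not_collinear_corner[OF assms]] bary_corner[OF assms]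
    by auto
qed

text \<open>The coordinate at \<open>c\<close> is at least 1/2 on the corner but 0 on the opposite
  side.\<close>

lemma corner_Int_opposite_edge:
  assumes "\<not> collinear {a, b, c}"
  shows "corner_triangle (convex hull {a, b, c}) c \<inter> closed_segment a b = {}"
proof -
  have "\<not> collinear {c, a, b}" "convex hull {a, b, c} = convex hull {c, a, b}"
    using assms by (simp_all add: insert_commute)
  note mem = mem_corner_triangle_iff_bary[OF this(1), folded this(2)]
  have False if "x \<in> corner_triangle (convex hull {a, b, c}) c" "x \<in> closed_segment a b" for x
    using that unfolding mem mem_closed_segment_iff_bary[OF assms] by linarith
  then show ?thesis by blast
qed

lemma red_refinement_Int_edge:
  assumes "\<not> collinear {a, b, c}" "P \<in> red_refinement (convex hull {a, b, c})"
  shows "P \<inter> closed_segment a b \<in> edge_pieces a b"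
proof -
  let ?K = "convex hull {a, b, c}"
  consider "P = medial_triangle ?K" | "P = corner_triangle ?K a" | "P = corner_triangle ?K b"
    | "P = corner_triangle ?K c"
    using assms(2) unfolding red_refinement_eq extreme_points_triangle[OF assms(1)] by blast
  then show ?thesis
  proof cases
    case 1
    then show ?thesis
      using medial_Int_edge_subset[OF assms(1)] by (auto simp: edge_pieces_def)
  next
    case 2
    then show ?thesis
      using corner_Int_edge[OF assms(1)] by (simp add: edge_pieces_def)
  next
    case 3
    have "\<not> collinear {b, a, c}"
      using assms(1) by (simp add: insert_commute)
    then show ?thesis
      using corner_Int_edge[of b a c] 3
      by (simp add: edge_pieces_def insert_commute closed_segment_commute[of b a] midpoint_sym[of b a])
  next
    case 4
    then show ?thesis
      using corner_Int_opposite_edge[OF assms(1)] by (simp add: edge_pieces_def)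
  qed
qed

section \<open>Conformity of the refined mesh\<close>

lemma triangulation_of_Int_cases:
  assumes "triangulation_of \<T> \<Omega>" "K \<in> \<T>" "L \<in> \<T>" "K \<noteq> L"
  obtains (disjoint) "K \<inter> L = {}"
  | (vertex) v where "v extreme_point_of K" "v extreme_point_of L" "K \<inter> L = {v}"
  | (edge) e where "e edge_of K" "e edge_of L" "K \<inter> L = e"
  using assms unfolding triangulation_of_def by blast

text \<open>A common face of two distinct triangles is empty, a vertex or a side, by its dimension;
  so conformity of a mesh may be checked through \<open>face_of\<close>.\<close>

lemma common_face_cases:
  fixes P Q :: triangle
  assumes "2 simplex P" "2 simplex Q" "P \<noteq> Q" "P \<inter> Q face_of P" "P \<inter> Q face_of Q"
  shows "P \<inter> Q = {} \<or>
    (\<exists>v. v extreme_point_of P \<and> v extreme_point_of Q \<and> P \<inter> Q = {v}) \<or>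
    (\<exists>e. e edge_of P \<and> e edge_of Q \<and> P \<inter> Q = e)"
proof -
  have conv: "convex P" "convex Q" "aff_dim P = 2" "aff_dim Q = 2"
    using assms(1,2) by (auto simp: simplex_def aff_dim_simplex)
  \<comment> \<open>A proper face has smaller dimension, and \<open>P \<inter> Q\<close> is proper
    in at least one of the two distinct triangles.\<close>
  have "aff_dim (P \<inter> Q) < 2"
    using face_of_aff_dim_lt[of P "P \<inter> Q"] face_of_aff_dim_lt[of Q "P \<inter> Q"] conv assms(3-5)
    by (metis inf.orderI)
  moreover have "-1 \<le> aff_dim (P \<inter> Q)"
    by (rule aff_dim_geq)
  ultimately consider "aff_dim (P \<inter> Q) = -1" | "aff_dim (P \<inter> Q) = 0" | "aff_dim (P \<inter> Q) = 1"
    by linarith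
  then show ?thesis
  proof cases
    case 1
    then show ?thesis using aff_dim_empty[of "P \<inter> Q"] by simp
  next
    case 2
    then obtain v where v: "P \<inter> Q = {v}" using aff_dim_eq_0[of "P \<inter> Q"] by auto
    then have "v extreme_point_of P" "v extreme_point_of Q"
      using assms(4,5) by (simp_all only: face_of_singleton)
    with v show ?thesis by blast
  next
    case 3
    then show ?thesis using assms(4,5) by (auto simp: edge_of_def)
  qed
qed

text \<open>For distinct parents everything happens inside \<open>K \<inter> L\<close>. A shared
  vertex stays extreme in the smaller set \<open>P\<close>. On a shared side the two traces meet in
  a face of the trace of \<open>P\<close>, which is itself a face of \<open>P\<close>; faces are
  transitive.\<close>

lemma red_refinements_Int_face_of:
  assumes \<T>: "triangulation_of \<T> \<Omega>" "K \<in> \<T>" "L \<in> \<T>"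
    and P: "P \<in> red_refinement K" and Q: "Q \<in> red_refinement L"
  shows "P \<inter> Q face_of P"
proof (cases "K = L")
  case True
  then show ?thesis
    using assms red_refinement_Int_face_of by (auto simp: triangulation_of_def)
next
  case False
  have K: "2 simplex K" and L: "2 simplex L"
    using \<T> by (auto simp: triangulation_of_def)
  have PK: "P \<subseteq> K" and QL: "Q \<subseteq> L"
    using red_refinement_subset K L P Q by auto
  from \<T> False show ?thesis
  proof (cases rule: triangulation_of_Int_cases)
    case disjoint
    then have "P \<inter> Q = {}" using PK QL by blast
    then show ?thesis by simp
  next
    case (vertex v)
    then have "P \<inter> Q \<subseteq> {v}" using PK QL by blast
    then consider "P \<inter> Q = {}" | "P \<inter> Q = {v}" by blast
    then show ?thesis
    proof cases
      case 2
      then show ?thesis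
        using vertex(1) PK face_of_subset[of "{v}" K P] by (simp add: face_of_singleton) blast
    qed simp
  next
    case (edge e)
    obtain a b c where abc: "\<not> collinear {a, b, c}" "K = convex hull {a, b, c}"
        "e = closed_segment a b"
      using K edge(1) by (rule triangle_with_edge)
    obtain a' b' c' where abc': "\<not> collinear {a', b', c'}" "L = convex hull {a', b', c'}"
        "e = closed_segment a' b'"
      using L edge(2) by (rule triangle_with_edge)
    \<comment> \<open>A segment determines its endpoints up to order, so both parents refer to the
      same list of pieces.\<close>
    have "{a, b} = {a', b'}"
      using abc(3) abc'(3) closed_segment_eq by metis
    then have "edge_pieces a' b' = edge_pieces a b"
      using edge_pieces_commute by (auto simp: doubleton_eq_iff)
    then have "P \<inter> e \<in> edge_pieces a b" "Q \<inter> e \<in> edge_pieces a b"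
      using red_refinement_Int_edge[OF abc(1) P[unfolded abc(2)]]
        red_refinement_Int_edge[OF abc'(1) Q[unfolded abc'(2)]]
      by (simp_all only: abc(3)[symmetric] abc'(3)[symmetric])
    then have "(P \<inter> e) \<inter> (Q \<inter> e) face_of P \<inter> e"
      by (rule edge_pieces_Int_face_of)
    also have "P \<inter> e face_of P"
    proof -
      have "convex P"
        using red_refinement_two_simplex[OF K P] by (auto simp: simplex_def)
      \<comment> \<open>Slicing the face \<open>e\<close> of \<open>K\<close> with the convex set
        \<open>P\<close> gives a face of \<open>K \<inter> P\<close>, which is
        \<open>P\<close>.\<close>
      then have "e \<inter> P face_of K \<inter> P"
        using edge(1) by (intro face_of_slice) (auto simp: edge_of_def)
      then show ?thesis
        using PK by (simp add: Int_commute Int_absorb1 inf_absorb1)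
    qed
    also have "(P \<inter> e) \<inter> (Q \<inter> e) = P \<inter> Q"
      using PK QL edge(3) by blast
    finally show ?thesis .
  qed
qed

lemma triangulation_of_red_refinement_mesh:
  assumes "triangulation_of \<T> \<Omega>"
  shows "triangulation_of (red_refinement_mesh \<T>) \<Omega>"
  unfolding triangulation_of_def
proof (intro conjI ballI impI)
  have simp2: "2 simplex K" if "K \<in> \<T>" for K
    using assms that by (simp add: triangulation_of_def)
  have "finite (red_refinement K)" if "2 simplex K" for K
    using that by (rule two_simplexE) (auto simp: red_refinement_eq extreme_points_triangle)
  then show "finite (red_refinement_mesh \<T>)"
    using assms simp2 by (auto simp: red_refinement_mesh_def triangulation_of_def)
  show s: "2 simplex P" if "P \<in> red_refinement_mesh \<T>" for P
    using that simp2 red_refinement_two_simplex by (auto simp: red_refinement_mesh_def)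
  have "\<Union>(red_refinement_mesh \<T>) = (\<Union>K\<in>\<T>. \<Union>(red_refinement K))"
    by (auto simp: red_refinement_mesh_def)
  also have "\<dots> = \<Union>\<T>"
    using simp2 Union_red_refinement by auto
  finally show "\<Union>(red_refinement_mesh \<T>) = closure \<Omega>"
    using assms by (simp add: triangulation_of_def)
  fix P Q
  assume PQ: "P \<in> red_refinement_mesh \<T>" "Q \<in> red_refinement_mesh \<T>" "P \<noteq> Q"
  \<comment> \<open>The face property is one-sided and is therefore used in both orders.\<close>
  have "P \<inter> Q face_of P" "Q \<inter> P face_of Q"
    using PQ red_refinements_Int_face_of[OF assms] by (auto simp: red_refinement_mesh_def)
  then show "P \<inter> Q = {} \<or>
    (\<exists>v. v extreme_point_of P \<and> v extreme_point_of Q \<and> P \<inter> Q = {v}) \<or>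
    (\<exists>e. e edge_of P \<and> e edge_of Q \<and> P \<inter> Q = e)"
    using PQ s by (intro common_face_cases) (auto simp: Int_commute)
qed

section \<open>Parents and shared edges in the refined mesh\<close>

text \<open>The vertex \<open>v\<close> tells them apart: its own coordinate is 1, which exceeds the
  bound 1/2 of the medial triangle.\<close>

lemma corner_triangle_neq_medial_triangle:
  assumes "2 simplex K" "v extreme_point_of K"
  shows "corner_triangle K v \<noteq> medial_triangle K"
proof -
  obtain b c where K: "\<not> collinear {v, b, c}" "K = convex hull {v, b, c}"
    using assms by (rule triangle_with_vertex)
  have "bary v b c v = 1"
    using K(1) by (simp add: bary_def collinear_iff_wedge2)
  then have "v \<notin> medial_triangle K"
    using mem_medial_triangle_iff_bary[OF K(1)] K(2) by auto
  moreover have "v \<in> corner_triangle K v"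
    unfolding corner_triangle_def using assms(2) by (intro hull_inc image_eqI[of _ _ v]) auto
  ultimately show ?thesis by blast
qed

lemma edge_not_subset_singleton:
  assumes "e edge_of P"
  shows "\<not> e \<subseteq> {x}"
  using assms aff_dim_subset[of e "{x}"] by (auto simp: edge_of_def)

text \<open>The empty and the one-point intersection have dimension -1 and 0, too small to contain
  \<open>S\<close>; only a common side remains.\<close>

lemma triangulation_of_Int_edge:
  assumes "triangulation_of \<T> \<Omega>" "K \<in> \<T>" "L \<in> \<T>" "K \<noteq> L"
    and "1 \<le> aff_dim S" "S \<subseteq> K \<inter> L"
  shows "K \<inter> L edge_of K" "K \<inter> L edge_of L"
proof -
  have dim: "1 \<le> aff_dim (K \<inter> L)"
    using assms(5,6) aff_dim_subset[of S "K \<inter> L"] by linarith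
  from assms(1-4) have "K \<inter> L edge_of K \<and> K \<inter> L edge_of L"
    by (cases rule: triangulation_of_Int_cases) (use dim in auto)
  then show "K \<inter> L edge_of K" "K \<inter> L edge_of L" by auto
qed

text \<open>Two parents would have a two-dimensional set in common, but the preceding lemma makes
  their intersection a side.\<close>

lemma red_refinement_parent_unique:
  assumes "triangulation_of \<T> \<Omega>" "K \<in> \<T>" "L \<in> \<T>"
    and "P \<in> red_refinement K" "P \<in> red_refinement L"
  shows "K = L"
proof (rule ccontr)
  assume ne: "K \<noteq> L"
  have KL: "2 simplex K" "2 simplex L"
    using assms(1-3) by (auto simp: triangulation_of_def)
  then have P: "P \<subseteq> K \<inter> L" "aff_dim P = 2"
    using assms(4,5) red_refinement_subset red_refinement_two_simplex aff_dim_simplex by blast+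
  then have "K \<inter> L edge_of K"
    using triangulation_of_Int_edge(1)[OF assms(1-3) ne, of P] by simp
  then show False
    using P aff_dim_subset[of P "K \<inter> L"] by (simp add: edge_of_def)
qed

text \<open>The medial triangle meets a side of \<open>K\<close> in at most a point, so it cannot
  contain \<open>e\<close>. The triangle \<open>P\<close> supplies the dimension of \<open>e\<close>
  and may be \<open>Q\<close> itself or a neighbour.\<close>

lemma red_refinement_boundary_edge_corner:
  assumes "2 simplex K" "f edge_of K" "e edge_of P" "e \<subseteq> f" "e \<subseteq> Q" "Q \<in> red_refinement K"
  obtains v where "v extreme_point_of K" "Q = corner_triangle K v"
proof -
  obtain a b c where K: "\<not> collinear {a, b, c}" "K = convex hull {a, b, c}" "f = closed_segment a b"
    using assms(1,2) by (rule triangle_with_edge)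
  have "Q \<noteq> medial_triangle K"
    using medial_Int_edge_subset[OF K(1)] K(2,3) assms(4,5) edge_not_subset_singleton[OF assms(3)]
    by blast
  then show ?thesis
    using that assms(6) by (auto simp: red_refinement_eq)
qed

text \<open>Distinct corners of one parent share at most a midpoint, so one of the two triangles
  must be medial.\<close>

lemma common_edge_red_refinement_same:
  assumes "2 simplex K" "P \<in> red_refinement K" "Q \<in> red_refinement K" "P \<noteq> Q"
    and "e edge_of P" "e edge_of Q"
  obtains v where "v extreme_point_of K"
    "P = medial_triangle K \<and> Q = corner_triangle K v \<or> P = corner_triangle K v \<and> Q = medial_triangle K"
proof -
  have "\<not> (P = corner_triangle K v \<and> Q = corner_triangle K w)"
    if "v extreme_point_of K" "w extreme_point_of K" for v w
    using corner_Int_corner_subset[OF assms(1) that] assms(4-6) edge_not_subset_singleton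
      edge_of_imp_subset[OF assms(5)] edge_of_imp_subset[OF assms(6)]
    by blast
  then show ?thesis
    using that assms(2-4) unfolding red_refinement_eq by blast
qed

section \<open>The two-colouring of the refined mesh\<close>

text \<open>The class inheriting the colour of \<open>U\<close>; swapping the arguments gives the
  other class.\<close>

definition red_colour_class :: "triangle set \<Rightarrow> triangle set \<Rightarrow> triangle set" where
  "red_colour_class U V =
     {corner_triangle K v | K v. K \<in> U \<and> v extreme_point_of K} \<union> medial_triangle ` V"

lemma red_colour_class_Un:
  "red_colour_class U V \<union> red_colour_class V U = red_refinement_mesh (U \<union> V)"
  by (auto simp: red_colour_class_def red_refinement_mesh_def red_refinement_eq)

text \<open>A common member would have a single parent. Two corners or two medial triangles would
  then put that parent in both \<open>U\<close> and \<open>V\<close>, and a corner never equals the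
  medial triangle of its parent.\<close>

lemma red_colour_class_disjoint:
  assumes "triangulation_of (U \<union> V) \<Omega>" "U \<inter> V = {}"
  shows "red_colour_class U V \<inter> red_colour_class V U = {}"
proof -
  have uniq: "K = L" if "K \<in> U \<union> V" "L \<in> U \<union> V" "P \<in> red_refinement K" "P \<in> red_refinement L" for K L P
    using red_refinement_parent_unique[OF assms(1)] that by blast
  have cr: "corner_triangle K v \<in> red_refinement K" if "v extreme_point_of K" for K v
    using that by (auto simp: red_refinement_eq)
  have mr: "medial_triangle K \<in> red_refinement K" for K
    by (simp add: red_refinement_eq)
  have ne: "corner_triangle K v \<noteq> medial_triangle L"
    if "K \<in> U \<union> V" "L \<in> U \<union> V" "v extreme_point_of K" for K L v
    using uniq[OF that(1,2) cr[OF that(3)]] mr[of L] corner_triangle_neq_medial_triangle[of K v]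
      assms(1) that by (metis triangulation_of_def)
  have cc: "corner_triangle K v \<noteq> corner_triangle L w"
    if "K \<in> U" "L \<in> V" "v extreme_point_of K" "w extreme_point_of L" for K L v w
    using uniq[of K L "corner_triangle K v"] cr[of v K] cr[of w L] that assms(2)
    by (metis IntI UnCI empty_iff)
  have mm: "medial_triangle K \<noteq> medial_triangle L" if "K \<in> U" "L \<in> V" for K L
    using uniq[of K L "medial_triangle K"] mr[of K] mr[of L] that assms(2)
    by (metis IntI UnCI empty_iff)
  show ?thesis
    unfolding red_colour_class_def using ne cc mm by (auto; metis)
qed

text \<open>Within one parent an arc joins a corner to the medial triangle, which have opposite
  colours. Across parents both ends are corners, coloured like their parents, and the parents are
  adjacent.\<close>

lemma red_colour_class_arc:
  assumes \<T>: "triangulation_of (U \<union> V) \<Omega>"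
    and arcs: "parcs (triangulation_graph (U \<union> V)) \<subseteq> U \<times> V \<union> V \<times> U"
    and P: "P \<in> red_refinement K" "K \<in> U \<union> V" and Q: "Q \<in> red_refinement L" "L \<in> U \<union> V"
    and e: "P \<noteq> Q" "e edge_of P" "e edge_of Q"
  shows "(P, Q) \<in> red_colour_class U V \<times> red_colour_class V U \<union>
    red_colour_class V U \<times> red_colour_class U V"
proof -
  have K: "2 simplex K" and L: "2 simplex L"
    using \<T> P(2) Q(2) by (auto simp: triangulation_of_def)
  show ?thesis
  proof (cases "K = L")
    case True
    then obtain v where "v extreme_point_of K"
      "P = medial_triangle K \<and> Q = corner_triangle K v \<or> P = corner_triangle K v \<and> Q = medial_triangle K"
      using common_edge_red_refinement_same[OF K P(1)] Q(1) e by metis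
    then show ?thesis
      using P(2) unfolding red_colour_class_def by blast
  next
    case False
    have sub: "e \<subseteq> P" "e \<subseteq> Q" "e \<subseteq> K \<inter> L"
      using edge_of_imp_subset e(2,3) red_refinement_subset K L P(1) Q(1) by blast+
    \<comment> \<open>The one-dimensional \<open>e\<close> lies in both parents, so they share a
      whole side and form an arc of the original graph.\<close>
    have f: "K \<inter> L edge_of K" "K \<inter> L edge_of L"
      using triangulation_of_Int_edge[OF \<T> P(2) Q(2) False _ sub(3)] e(2) by (auto simp: edge_of_def)
    then have "(K, L) \<in> parcs (triangulation_graph (U \<union> V))"
      using False P(2) Q(2) by (auto simp: triangulation_graph_def)
    then have KL: "(K, L) \<in> U \<times> V \<union> V \<times> U"
      using arcs by blast
    obtain v where v: "v extreme_point_of K" "P = corner_triangle K v"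
      using red_refinement_boundary_edge_corner[OF K f(1) e(2) sub(3) sub(1) P(1)] .
    obtain w where w: "w extreme_point_of L" "Q = corner_triangle L w"
      using red_refinement_boundary_edge_corner[OF L f(2) e(2) sub(3) sub(2) Q(1)] .
    show ?thesis
      using KL v w unfolding red_colour_class_def by blast
  qed
qed

theorem theorem2p14:
  fixes \<Omega> :: "(real^2) set" and \<T> :: "triangle set"
  assumes "open \<Omega>" and "bounded \<Omega>" and "simply_connected \<Omega>" and "polygonal \<Omega>"
    and "bipartite_triangulation_of \<T> \<Omega>"
  shows "bipartite_triangulation_of (red_refinement_mesh \<T>) \<Omega>"
proof -
  have \<T>: "triangulation_of \<T> \<Omega>"
    using assms(5) by (simp add: bipartite_triangulation_of_def)
  obtain U V where UV: "\<T> = U \<union> V" "U \<inter> V = {}"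
      "parcs (triangulation_graph \<T>) \<subseteq> U \<times> V \<union> V \<times> U"
    using assms(5) by (auto simp: bipartite_triangulation_of_def bipartite_def triangulation_graph_def)
  have "parcs (triangulation_graph (red_refinement_mesh \<T>)) \<subseteq>
      red_colour_class U V \<times> red_colour_class V U \<union> red_colour_class V U \<times> red_colour_class U V"
  proof (rule subrelI)
    fix P Q assume "(P, Q) \<in> parcs (triangulation_graph (red_refinement_mesh \<T>))"
    then obtain K L e where "P \<in> red_refinement K" "K \<in> U \<union> V"
        "Q \<in> red_refinement L" "L \<in> U \<union> V" "P \<noteq> Q" "e edge_of P" "e edge_of Q"
      by (simp add: triangulation_graph_def red_refinement_mesh_def UV(1)) blast
    then show "(P, Q) \<in> red_colour_class U V \<times> red_colour_class V U \<union>
        red_colour_class V U \<times> red_colour_class U V"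
      by (rule red_colour_class_arc[OF \<T>[unfolded UV(1)] UV(3)[unfolded UV(1)]])
  qed
  then have "bipartite (triangulation_graph (red_refinement_mesh \<T>))"
    unfolding bipartite_def
    using red_colour_class_Un[of U V] red_colour_class_disjoint[OF \<T>[unfolded UV(1)] UV(2)] UV(1)
    by (intro exI[of _ "red_colour_class U V"] exI[of _ "red_colour_class V U"])
      (simp add: triangulation_graph_def)
  then show ?thesis
    using triangulation_of_red_refinement_mesh[OF \<T>] by (simp add: bipartite_triangulation_of_def)
qed

end
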